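(* Let $N>0$ be an integer. Then for every integer $n\ge 0$, $$\sum_{i=0}^{4N+1} F(n+i) = L(2N+1)\,F(n+2N+2).$$
   Context: The Fibonacci numbers are defined by $F(0)=0$, $F(1)=1$, $F(n)=F(n-1)+F(n-2)$ for $n\ge 2$. The Lucas numbers are defined by $L(0)=2$, $L(1)=1$, $L(n)=L(n-1)+L(n-2)$ for $n\ge 2$. *)

theory Defs
  imports "HOL-Number_Theory.Fib"
begin

fun lucas :: "nat \<Rightarrow> nat" where
  "lucas 0 = 2"
| "lucas (Suc 0) = 1"
| "lucas (Suc (Suc n)) = lucas (Suc n) + lucas n"

end

theory Submission
  imports Defs
begin

text \<open>The sum telescopes to F(n+4N+3) - F(n+1) (\<open>sum_fib_shift\<close>). These two
  indices lie symmetrically about n+2N+2, at distance 2N+1. As 2N+1 is odd, the sign in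
  \<open>lucas_mult_fib\<close> is negative, so the difference is the product.\<close>

lemma sum_fib_shift: "(\<Sum>i = 0..k. fib (n + i)) + fib (n + 1) = fib (n + k + 2)"
  by (induction k) simp_all

text \<open>In Binet form, expanding the product leaves a cross term with (\<alpha>\<beta>)^m =
  (-1)^m. The proof is by induction instead; \<open>int\<close> accommodates the sign.\<close>

lemma lucas_mult_fib:
  "int (lucas m) * int (fib (b + m)) = int (fib (b + 2 * m)) + (-1) ^ m * int (fib b)"
proof (induction m arbitrary: b rule: lucas.induct)
  case (3 m)
  \<comment> \<open>Splitting L(m+2) keeps the Fibonacci index fixed, so the base \<open>b\<close>
    shifts by 1 and 2; hence \<open>b\<close> is arbitrary.\<close>
  have "int (lucas (Suc (Suc m))) * int (fib (b + Suc (Suc m)))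
      = int (lucas (Suc m)) * int (fib ((b + 1) + Suc m)) + int (lucas m) * int (fib ((b + 2) + m))"
    by (simp add: algebra_simps)
  also have "\<dots> = int (fib (b + 1 + 2 * Suc m)) + (-1) ^ Suc m * int (fib (b + 1))
      + (int (fib (b + 2 + 2 * m)) + (-1) ^ m * int (fib (b + 2)))"
    by (simp only: 3)
  also have "\<dots> = int (fib (b + 2 * Suc (Suc m))) + (-1) ^ Suc (Suc m) * int (fib b)"
    by (simp add: algebra_simps)
  finally show ?case .
qed simp_all

theorem theorem5p1:
  fixes N n :: nat
  assumes "N > 0"
  shows "(\<Sum>i = 0..4 * N + 1. fib (n + i)) = lucas (2 * N + 1) * fib (n + 2 * N + 2)"
proof -
  have idx: "n + 1 + (2 * N + 1) = n + 2 * N + 2"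
    "n + 1 + 2 * (2 * N + 1) = n + (4 * N + 1) + 2"
    by simp_all
  have "int (lucas (2 * N + 1) * fib (n + 2 * N + 2)) = int (fib (n + (4 * N + 1) + 2)) - int (fib (n + 1))"
    using lucas_mult_fib[of "2 * N + 1" "n + 1"] unfolding idx by simp
  with sum_fib_shift[of n "4 * N + 1"] show ?thesis
    by linarith
qed

end
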